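(* Let $G$ be a finitely generated group that is not virtually abelian. Then there exists a finite symmetric generating set $S\subseteq G\setminus\{1\}$ such that the automorphism group of the Cayley graph $\mathrm{Cay}(G,S)$ consists exactly of the left-translations $h\mapsto gh$, $g\in G$.
   Context: A subset $S$ of a group is symmetric if $S=S^{-1}$. Given a group $G$ and a symmetric generating set $S\subseteq G\setminus\{1\}$, the Cayley graph $\mathrm{Cay}(G,S)$ is the simple unoriented graph with vertex set $G$ and an edge between $g$ and $h$ precisely when $g^{-1}h\in S$. The group $G$ acts on it by graph automorphisms via left multiplication. A group is virtually abelian if it has an abelian subgroup of finite index. *)

theory Defs
  imports "HOL-Algebra.Generated_Groups" "HOL-Algebra.Bij"
begin

section \<open>Groups\<close>

definition finitely_generated :: "('a, 'b) monoid_scheme \<Rightarrow> bool" where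
  "finitely_generated G \<longleftrightarrow>
     (\<exists>A. finite A \<and> A \<subseteq> carrier G \<and> generate G A = carrier G)"

definition virtually_abelian :: "('a, 'b) monoid_scheme \<Rightarrow> bool" where
  "virtually_abelian G \<longleftrightarrow>
     (\<exists>H. subgroup H G \<and> comm_group (G\<lparr>carrier := H\<rparr>) \<and> finite (rcosets\<^bsub>G\<^esub> H))"

definition symmetric_subset :: "('a, 'b) monoid_scheme \<Rightarrow> 'a set \<Rightarrow> bool" where
  "symmetric_subset G S \<longleftrightarrow> S \<subseteq> carrier G \<and> S = set_inv\<^bsub>G\<^esub> S"


section \<open>Simple graphs and their automorphisms\<close>

text \<open>
  Unoriented graphs on a possibly infinite vertex set; an edge is the unordered pair of its
  two distinct endpoints.
\<close>

record 'a sgraph =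
  verts :: "'a set"
  edges :: "'a set set"

definition simple_graph :: "'a sgraph \<Rightarrow> bool" where
  "simple_graph \<Gamma> \<longleftrightarrow> (\<forall>e\<in>edges \<Gamma>. e \<subseteq> verts \<Gamma> \<and> card e = 2)"

text \<open>
  As for \<^const>\<open>auto\<close> in \<^theory>\<open>HOL-Algebra.Bij\<close>, automorphisms are extensional functions
  (\<^const>\<open>undefined\<close> outside the vertex set), so that two automorphisms are equal as soon as
  they agree on the vertices.
\<close>

definition graph_auto :: "'a sgraph \<Rightarrow> ('a \<Rightarrow> 'a) set" where
  "graph_auto \<Gamma> =
     {\<phi> \<in> Bij (verts \<Gamma>).
        \<forall>u\<in>verts \<Gamma>. \<forall>v\<in>verts \<Gamma>. {u, v} \<in> edges \<Gamma> \<longleftrightarrow> {\<phi> u, \<phi> v} \<in> edges \<Gamma>}"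

definition graph_AutoGroup :: "'a sgraph \<Rightarrow> ('a \<Rightarrow> 'a) monoid" where
  "graph_AutoGroup \<Gamma> = BijGroup (verts \<Gamma>)\<lparr>carrier := graph_auto \<Gamma>\<rparr>"

lemma subgroup_graph_auto: "subgroup (graph_auto \<Gamma>) (BijGroup (verts \<Gamma>))"
proof (rule group.subgroupI[OF group_BijGroup])
  show "graph_auto \<Gamma> \<subseteq> carrier (BijGroup (verts \<Gamma>))"
    by (auto simp: graph_auto_def BijGroup_def)
  show "graph_auto \<Gamma> \<noteq> {}"
    using id_Bij[of "verts \<Gamma>"] by (fastforce simp: graph_auto_def)
next
  fix \<phi> assume a: "\<phi> \<in> graph_auto \<Gamma>"
  then have B: "\<phi> \<in> Bij (verts \<Gamma>)" by (simp add: graph_auto_def)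
  define \<psi> where "\<psi> = restrict (inv_into (verts \<Gamma>) \<phi>) (verts \<Gamma>)"
  have \<psi>: "\<psi> u \<in> verts \<Gamma>" "\<phi> (\<psi> u) = u" if "u \<in> verts \<Gamma>" for u
    using B that by (auto simp: \<psi>_def Bij_def bij_betw_def inv_into_into f_inv_into_f)
  have "\<psi> \<in> graph_auto \<Gamma>"
    using a \<psi> restrict_inv_into_Bij[OF B] by (auto simp: graph_auto_def \<psi>_def[symmetric])
  then show "inv\<^bsub>BijGroup (verts \<Gamma>)\<^esub> \<phi> \<in> graph_auto \<Gamma>"
    using B by (simp add: inv_BijGroup \<psi>_def)
next
  fix \<phi> \<psi> assume a: "\<phi> \<in> graph_auto \<Gamma>" "\<psi> \<in> graph_auto \<Gamma>"
  then have B: "\<phi> \<in> Bij (verts \<Gamma>)" "\<psi> \<in> Bij (verts \<Gamma>)" by (simp_all add: graph_auto_def)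
  have "\<psi> u \<in> verts \<Gamma>" if "u \<in> verts \<Gamma>" for u
    using B(2) that Bij_imp_funcset by blast
  then have "compose (verts \<Gamma>) \<phi> \<psi> \<in> graph_auto \<Gamma>"
    using a compose_Bij[OF B] by (simp add: graph_auto_def compose_eq)
  then show "\<phi> \<otimes>\<^bsub>BijGroup (verts \<Gamma>)\<^esub> \<psi> \<in> graph_auto \<Gamma>"
    using B by (simp add: BijGroup_def)
qed

lemma group_graph_AutoGroup: "group (graph_AutoGroup \<Gamma>)"
  unfolding graph_AutoGroup_def
  by (rule subgroup.subgroup_is_group[OF subgroup_graph_auto group_BijGroup])


section \<open>Cayley graphs\<close>

definition Cay :: "('a, 'b) monoid_scheme \<Rightarrow> 'a set \<Rightarrow> 'a sgraph" where
  "Cay G S =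
     \<lparr>verts = carrier G,
      edges = {{g, h} |g h. g \<in> carrier G \<and> h \<in> carrier G \<and> inv\<^bsub>G\<^esub> g \<otimes>\<^bsub>G\<^esub> h \<in> S}\<rparr>"

lemma verts_Cay [simp]: "verts (Cay G S) = carrier G"
  by (simp add: Cay_def)

lemma (in group) edge_Cay_iff:
  assumes "symmetric_subset G S" "g \<in> carrier G" "h \<in> carrier G"
  shows "{g, h} \<in> edges (Cay G S) \<longleftrightarrow> inv g \<otimes> h \<in> S"
proof -
  have "inv h \<otimes> g \<in> S \<Longrightarrow> inv g \<otimes> h \<in> S"
  proof -
    assume "inv h \<otimes> g \<in> S"
    then have "inv (inv h \<otimes> g) \<in> S"
      using assms(1) by (auto simp: symmetric_subset_def SET_INV_def)
    then show "inv g \<otimes> h \<in> S"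
      using assms(2,3) by (simp add: inv_mult_group)
  qed
  then show ?thesis
    using assms(2,3) by (auto simp: Cay_def doubleton_eq_iff)
qed

lemma (in group) simple_graph_Cay:
  assumes "\<one> \<notin> S"
  shows "simple_graph (Cay G S)"
  using assms by (auto simp: simple_graph_def Cay_def card_2_iff) (metis l_inv)

end

theory Submission
  imports Defs
begin

text \<open>
  Let \<open>F\<close> be the FC-centre of \<open>G\<close>, the elements with finite conjugacy class. It has infinite index:
  otherwise it would be finitely generated by Schreier's lemma, and its centre, the intersection of
  finitely many centralizers of finite index, would be an abelian subgroup of finite index.
  By B. H. Neumann's lemma \<open>G\<close> is not a finite union of cosets of subgroups of infinite index, so a
  generic \<open>g\<close> satisfies none of finitely many equations \<open>g a g\<inverse> = b\<close> with \<open>a \<notin> F\<close>, and, by a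
  pigeonhole argument, none of finitely many equations \<open>g d g = b\<close>. This replaces the random walks
  of the original proof.

  An automorphism of \<open>Cay(G, S)\<close> preserves the number of triangles on an edge. Adding
  \<open>g\<^sup>\<plusminus>\<^sup>1, (g s)\<^sup>\<plusminus>\<^sup>1\<close> to \<open>S\<close> for a generic \<open>g\<close> adds triangles to the edges coloured \<open>s\<^sup>\<plusminus>\<^sup>1\<close> and to no
  other old edge, while each new edge lies in at most 8 triangles. Repeating this, all elements of a
  prescribed finite \<open>P \<subseteq> G - F\<close> get pairwise different counts above 8, up to inversion, so that
  every automorphism \<open>\<phi>\<close> satisfies \<open>\<phi>(x u) = \<phi>(x) u\<^sup>\<plusminus>\<^sup>1\<close> for \<open>u \<in> P\<close>. Finally \<open>G\<close> has a finite
  generating set \<open>T\<close> outside \<open>F\<close>; if for each \<open>s \<in> T\<close> also \<open>g\<close> and \<open>s g\<close> lie in \<open>P\<close> for a generic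
  \<open>g\<close>, then \<open>\<phi>(x s) = \<phi>(x) s\<close>, and \<open>\<phi>\<close> is a translation.
\<close>

section \<open>Subgroups of infinite index\<close>

text \<open>On \<open>A\<close>, \<open>h\<close> factors through \<open>f\<close>, so the image of
  \<open>h\<close> is an image of the finite image of \<open>f\<close>.\<close>

lemma finite_image_factor:
  assumes "finite (f ` A)" "\<And>x y. x \<in> A \<Longrightarrow> y \<in> A \<Longrightarrow> f x = f y \<Longrightarrow> h x = h y"
  shows "finite (h ` A)"
proof -
  have "h ` A \<subseteq> (\<lambda>v. h (SOME x. x \<in> A \<and> f x = v)) ` f ` A"
  proof (rule image_subsetI)
    fix x assume x: "x \<in> A"
    have "(SOME y. y \<in> A \<and> f y = f x) \<in> A \<and> f (SOME y. y \<in> A \<and> f y = f x) = f x"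
      by (rule someI[of _ x]) (use x in auto)
    then show "h x \<in> (\<lambda>v. h (SOME x. x \<in> A \<and> f x = v)) ` f ` A"
      using x assms(2)[of "SOME y. y \<in> A \<and> f y = f x" x] by (intro image_eqI[of _ _ "f x"]) auto
  qed
  then show ?thesis by (rule finite_subset) (use assms(1) in simp)
qed

context group
begin

lemma inv_l_cancel: "x \<in> carrier G \<Longrightarrow> y \<in> carrier G \<Longrightarrow> inv x \<otimes> (x \<otimes> y) = y"
  by (simp flip: m_assoc)

lemma inv_r_cancel: "x \<in> carrier G \<Longrightarrow> y \<in> carrier G \<Longrightarrow> x \<otimes> (inv x \<otimes> y) = y"
  by (simp flip: m_assoc)

lemmas group_normalize = m_assoc inv_mult_group inv_l_cancel inv_r_cancel

text \<open>\<open>inv k \<otimes> x \<notin> H\<close> says that \<open>x\<close> lies outside the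
  left coset \<open>k H\<close>, so no finite family of left cosets covers the group. For a subgroup
  this is infinite index, in the form suited to covering arguments.\<close>

definition infinite_index :: "'a set \<Rightarrow> bool" where
  "infinite_index H \<longleftrightarrow>
     (\<forall>K. finite K \<and> K \<subseteq> carrier G \<longrightarrow> (\<exists>x\<in>carrier G. \<forall>k\<in>K. inv k \<otimes> x \<notin> H))"

text \<open>B. H. Neumann's lemma, by induction on the number of subgroups. A coset
  \<open>x H\<close> missed by the given cosets of \<open>H\<close> would have to be covered by
  cosets of the other subgroups; translates of these would then cover all given cosets of
  \<open>H\<close>.\<close>

lemma neumann_covering:
  assumes "finite \<H>" "\<And>H. H \<in> \<H> \<Longrightarrow> subgroup H G \<and> infinite_index H"
    and "finite K" "K \<subseteq> carrier G"
  shows "\<exists>x\<in>carrier G. \<forall>H\<in>\<H>. \<forall>k\<in>K. inv k \<otimes> x \<notin> H"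
  using assms
proof (induction \<H> arbitrary: K rule: finite_induct)
  case empty
  then show ?case by auto
next
  case (insert H \<H>)
  then have H: "subgroup H G" "infinite_index H" by auto
  obtain x where x: "x \<in> carrier G" "\<forall>k\<in>K. inv k \<otimes> x \<notin> H"
    using H(2) insert.prems unfolding infinite_index_def by meson
  \<comment> \<open>Since \<open>inv (k \<otimes> inv x \<otimes> l) \<otimes> y = inv l \<otimes>
    (x \<otimes> (inv k \<otimes> y))\<close>, the added elements also keep the point moved into
    \<open>x H\<close> off the cosets of the other subgroups.\<close>
  define K' where "K' = K \<union> (\<lambda>(k, l). k \<otimes> inv x \<otimes> l) ` (K \<times> K)"
  have "finite K'" "K' \<subseteq> carrier G"
    using insert.prems x by (auto simp: K'_def)
  then obtain y where y: "y \<in> carrier G" "\<forall>H\<in>\<H>. \<forall>k\<in>K'. inv k \<otimes> y \<notin> H"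
    using insert.IH insert.prems by (metis insertCI)
  show ?case
  proof (cases "\<exists>k\<in>K. inv k \<otimes> y \<in> H")
    case False
    then show ?thesis using y by (auto simp: K'_def)
  next
    case True
    \<comment> \<open>The coset \<open>y H = k H\<close> is moved onto \<open>x H\<close>, which is disjoint from all \<open>l H\<close>.\<close>
    then obtain k where k: "k \<in> K" "inv k \<otimes> y \<in> H" by auto
    define z where "z = x \<otimes> (inv k \<otimes> y)"
    have kc: "k \<in> carrier G" using k insert.prems by auto
    have z: "z \<in> carrier G" using x kc y by (simp add: z_def)
    have "inv l \<otimes> z \<notin> H" if "l \<in> K" for l
    proof
      assume a: "inv l \<otimes> z \<in> H"
      have lc: "l \<in> carrier G" using that insert.prems by auto
      have "inv l \<otimes> z \<otimes> inv (inv k \<otimes> y) \<in> H"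
        using a k H(1) by (simp add: subgroup.m_closed subgroup.m_inv_closed)
      also have "inv l \<otimes> z \<otimes> inv (inv k \<otimes> y) = inv l \<otimes> x"
        using x kc y lc by (simp add: z_def group_normalize)
      finally show False using x that by auto
    qed
    moreover have "inv l \<otimes> z \<notin> H'" if "l \<in> K" "H' \<in> \<H>" for l H'
    proof -
      have lc: "l \<in> carrier G" using that insert.prems by auto
      have "k \<otimes> inv x \<otimes> l \<in> K'" using k that by (force simp: K'_def)
      then have "inv (k \<otimes> inv x \<otimes> l) \<otimes> y \<notin> H'" using y that by auto
      also have "inv (k \<otimes> inv x \<otimes> l) \<otimes> y = inv l \<otimes> z"
        using x kc y lc by (simp add: z_def group_normalize)
      finally show ?thesis .
    qed
    ultimately show ?thesis using z by auto
  qed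
qed


section \<open>The FC-centre\<close>

definition fc_center :: "'a set" where
  "fc_center = {x \<in> carrier G. finite ((\<lambda>g. g \<otimes> x \<otimes> inv g) ` carrier G)}"

lemma subgroup_fc_center: "subgroup fc_center G"
proof (rule subgroupI)
  show "fc_center \<subseteq> carrier G" by (auto simp: fc_center_def)
  have "(\<lambda>g. g \<otimes> \<one> \<otimes> inv g) ` carrier G \<subseteq> {\<one>}" by auto
  then have "\<one> \<in> fc_center"
    by (simp add: fc_center_def finite_subset[of _ "{\<one>}"])
  then show "fc_center \<noteq> {}" by auto
next
  fix a assume a: "a \<in> fc_center"
  have "(\<lambda>g. g \<otimes> inv a \<otimes> inv g) ` carrier G = m_inv G ` (\<lambda>g. g \<otimes> a \<otimes> inv g) ` carrier G"
    unfolding image_image using a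
    by (intro image_cong refl) (simp add: fc_center_def group_normalize)
  with a show "inv a \<in> fc_center" by (auto simp: fc_center_def)
next
  fix a b assume ab: "a \<in> fc_center" "b \<in> fc_center"
  have "(\<lambda>g. g \<otimes> (a \<otimes> b) \<otimes> inv g) ` carrier G \<subseteq>
    (\<lambda>(u, v). u \<otimes> v) ` ((\<lambda>g. g \<otimes> a \<otimes> inv g) ` carrier G \<times> (\<lambda>g. g \<otimes> b \<otimes> inv g) ` carrier G)"
  proof (rule image_subsetI)
    fix g assume "g \<in> carrier G"
    with ab show "g \<otimes> (a \<otimes> b) \<otimes> inv g \<in> (\<lambda>(u, v). u \<otimes> v) `
        ((\<lambda>g. g \<otimes> a \<otimes> inv g) ` carrier G \<times> (\<lambda>g. g \<otimes> b \<otimes> inv g) ` carrier G)"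
      by (intro image_eqI[of _ _ "(g \<otimes> a \<otimes> inv g, g \<otimes> b \<otimes> inv g)"])
         (auto simp: fc_center_def group_normalize)
  qed
  from finite_subset[OF this] ab show "a \<otimes> b \<in> fc_center"
    by (simp add: fc_center_def)
qed

lemma fc_center_conj:
  assumes "x \<in> fc_center" "y \<in> carrier G"
  shows "y \<otimes> x \<otimes> inv y \<in> fc_center"
proof -
  have x: "x \<in> carrier G" using assms by (simp add: fc_center_def)
  have "(\<lambda>g. g \<otimes> (y \<otimes> x \<otimes> inv y) \<otimes> inv g) ` carrier G \<subseteq> (\<lambda>g. g \<otimes> x \<otimes> inv g) ` carrier G"
  proof (rule image_subsetI)
    fix g assume "g \<in> carrier G"
    then show "g \<otimes> (y \<otimes> x \<otimes> inv y) \<otimes> inv g \<in> (\<lambda>g. g \<otimes> x \<otimes> inv g) ` carrier G"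
      using assms x by (intro image_eqI[of _ _ "g \<otimes> y"]) (auto simp: group_normalize)
  qed
  from finite_subset[OF this] assms x show ?thesis by (simp add: fc_center_def)
qed

lemma fc_center_conj_iff:
  assumes "x \<in> carrier G" "y \<in> carrier G"
  shows "y \<otimes> x \<otimes> inv y \<in> fc_center \<longleftrightarrow> x \<in> fc_center"
  using fc_center_conj[of "y \<otimes> x \<otimes> inv y" "inv y"] fc_center_conj[of x y] assms
  by (auto simp: group_normalize)

text \<open>The two products are conjugate by \<open>y\<close>. This passes between left and right
  cosets of the FC-centre.\<close>

lemma fc_center_commute:
  assumes "x \<in> carrier G" "y \<in> carrier G"
  shows "x \<otimes> y \<in> fc_center \<longleftrightarrow> y \<otimes> x \<in> fc_center"
  using fc_center_conj_iff[of "x \<otimes> y" y] assms by (simp add: group_normalize)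

lemma fc_center_inv_iff:
  assumes "x \<in> carrier G"
  shows "inv x \<in> fc_center \<longleftrightarrow> x \<in> fc_center"
  using subgroup.m_inv_closed[OF subgroup_fc_center] assms by fastforce

section \<open>Centralizers and the index of the FC-centre\<close>

definition centralizer :: "'a \<Rightarrow> 'a set" where
  "centralizer a = {g \<in> carrier G. g \<otimes> a = a \<otimes> g}"

lemma subgroup_centralizer:
  assumes "a \<in> carrier G"
  shows "subgroup (centralizer a) G"
proof (rule subgroupI)
  fix g assume g: "g \<in> centralizer a"
  then have "inv g \<otimes> (g \<otimes> a) \<otimes> inv g = inv g \<otimes> (a \<otimes> g) \<otimes> inv g"
    by (simp add: centralizer_def)
  moreover have gc: "g \<in> carrier G" using g by (simp add: centralizer_def)
  ultimately have "a \<otimes> inv g = inv g \<otimes> a"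
    using assms by (simp add: group_normalize)
  with gc show "inv g \<in> centralizer a" by (simp add: centralizer_def)
next
  fix g h assume gh: "g \<in> centralizer a" "h \<in> centralizer a"
  then have c: "g \<in> carrier G" "h \<in> carrier G" "g \<otimes> a = a \<otimes> g" "h \<otimes> a = a \<otimes> h"
    by (auto simp: centralizer_def)
  have "g \<otimes> h \<otimes> a = g \<otimes> a \<otimes> h"
    using c(1,2,4) assms by (simp add: m_assoc)
  also have "\<dots> = a \<otimes> (g \<otimes> h)"
    using c(1,2,3) assms by (simp add: m_assoc)
  finally show "g \<otimes> h \<in> centralizer a"
    using c by (simp add: centralizer_def)
qed (use assms in \<open>auto simp: centralizer_def\<close>)

text \<open>The solutions \<open>g\<close> of \<open>g \<otimes> a \<otimes> inv g = b\<close> thus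
  lie in a single left coset of the centralizer, so \<open>neumann_covering\<close> can exclude
  them.\<close>

lemma conj_eq_imp_centralizer:
  assumes "a \<in> carrier G" "g \<in> carrier G" "h \<in> carrier G"
    and "g \<otimes> a \<otimes> inv g = h \<otimes> a \<otimes> inv h"
  shows "inv g \<otimes> h \<in> centralizer a"
proof -
  have "inv g \<otimes> (g \<otimes> a \<otimes> inv g) \<otimes> h = inv g \<otimes> (h \<otimes> a \<otimes> inv h) \<otimes> h"
    using assms(4) by simp
  with assms(1-3) show ?thesis by (simp add: centralizer_def group_normalize)
qed

text \<open>If the cosets of finitely many \<open>k\<close> covered the group, every conjugate of
  \<open>a\<close> would be its conjugate by one of these \<open>k\<close>.\<close>

lemma infinite_index_centralizer:
  assumes "a \<in> carrier G" "a \<notin> fc_center"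
  shows "infinite_index (centralizer a)"
  unfolding infinite_index_def
proof (intro allI impI)
  fix K assume K: "finite K \<and> K \<subseteq> carrier G"
  show "\<exists>x\<in>carrier G. \<forall>k\<in>K. inv k \<otimes> x \<notin> centralizer a"
  proof (rule ccontr)
    assume "\<not> ?thesis"
    then have *: "\<exists>k\<in>K. inv k \<otimes> x \<in> centralizer a" if "x \<in> carrier G" for x
      using that by auto
    have "(\<lambda>g. g \<otimes> a \<otimes> inv g) ` carrier G \<subseteq> (\<lambda>g. g \<otimes> a \<otimes> inv g) ` K"
    proof (rule image_subsetI)
      fix x assume x: "x \<in> carrier G"
      then obtain k where k: "k \<in> K" "inv k \<otimes> x \<in> centralizer a" using * by blast
      then have kc: "k \<in> carrier G" using K by auto
      have "k \<otimes> (inv k \<otimes> x \<otimes> a) \<otimes> inv x = k \<otimes> (a \<otimes> (inv k \<otimes> x)) \<otimes> inv x"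
        using k by (simp add: centralizer_def)
      then have "x \<otimes> a \<otimes> inv x = k \<otimes> a \<otimes> inv k"
        using x kc assms by (simp add: group_normalize)
      then show "x \<otimes> a \<otimes> inv x \<in> (\<lambda>g. g \<otimes> a \<otimes> inv g) ` K" using k by auto
    qed
    then show False
      using assms K finite_subset[OF _ finite_imageI[of K]] by (auto simp: fc_center_def)
  qed
qed

text \<open>The finite set \<open>U\<close> consists of the Schreier generators, enlarged by \<open>T \<inter> H\<close>.\<close>
lemma schreier:
  assumes A: "finite A" "A \<subseteq> carrier G" "generate G A = carrier G"
    and H: "subgroup H G"
    and T: "finite T" "T \<subseteq> carrier G" "\<And>x. x \<in> carrier G \<Longrightarrow> \<exists>t\<in>T. x \<otimes> inv t \<in> H"
  shows "\<exists>U. finite U \<and> U \<subseteq> H \<and> H \<subseteq> generate G U"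
proof -
  \<comment> \<open>Adjoining \<open>\<one>\<close> allows the rewriting of \<open>h\<close> to
    start from \<open>\<one> \<otimes> \<one> \<otimes> h\<close>.\<close>
  define T1 where "T1 = insert \<one> T"
  have T1: "T1 \<subseteq> carrier G" using T by (auto simp: T1_def)
  define A' where "A' = A \<union> m_inv G ` A"
  have A': "finite A'" "A' \<subseteq> carrier G" using A by (auto simp: A'_def)
  define U where
    "U = ((\<lambda>(t, a, t'). t \<otimes> a \<otimes> inv t') ` (T1 \<times> A' \<times> T1) \<union> T1) \<inter> H"
  have fin: "finite U" using A' T by (auto simp: U_def T1_def)
  have UH: "U \<subseteq> H" by (auto simp: U_def)
  then have UG: "U \<subseteq> carrier G" using subgroup.subset[OF H] by auto
  note genU = generate_in_carrier[OF UG]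
  have gen: "\<exists>k'\<in>generate G U. \<exists>t'\<in>T1. k \<otimes> t \<otimes> a = k' \<otimes> t'"
    if "k \<in> generate G U" "t \<in> T1" "a \<in> A'" for k t a
  proof -
    have c: "k \<in> carrier G" "t \<in> carrier G" "a \<in> carrier G"
      using that genU T1 A' by auto
    then obtain t' where t': "t' \<in> T" "t \<otimes> a \<otimes> inv t' \<in> H" using T(3)[of "t \<otimes> a"] by auto
    have c': "t' \<in> carrier G" using t' T by auto
    have "t \<otimes> a \<otimes> inv t' \<in> U" using that t' by (force simp: U_def T1_def)
    then have "k \<otimes> (t \<otimes> a \<otimes> inv t') \<in> generate G U"
      using that by (simp add: generate.eng generate.incl)
    moreover have "k \<otimes> t \<otimes> a = k \<otimes> (t \<otimes> a \<otimes> inv t') \<otimes> t'"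
      using c c' by (simp add: group_normalize)
    ultimately show ?thesis using t' by (auto simp: T1_def)
  qed
  \<comment> \<open>The products of \<open>generate G U\<close> with \<open>T1\<close> are stable
    under right multiplication by generators and their inverses, hence by the whole group.\<close>
  have step: "\<exists>k'\<in>generate G U. \<exists>t'\<in>T1. k \<otimes> t \<otimes> g = k' \<otimes> t'"
    if "g \<in> generate G A" "k \<in> generate G U" "t \<in> T1" for g k t
    using that
  proof (induction g arbitrary: k t rule: generate.induct)
    case one
    then have "k \<otimes> t \<otimes> \<one> = k \<otimes> t" using genU T1 by auto
    with one show ?case by blast
  next
    case (incl h)
    then show ?case by (intro gen) (auto simp: A'_def)
  next
    case (inv h)
    then show ?case by (intro gen) (auto simp: A'_def)
  next
    case (eng h1 h2)
    obtain k1 t1 where 1: "k1 \<in> generate G U" "t1 \<in> T1" "k \<otimes> t \<otimes> h1 = k1 \<otimes> t1"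
      using eng by blast
    obtain k2 t2 where 2: "k2 \<in> generate G U" "t2 \<in> T1" "k1 \<otimes> t1 \<otimes> h2 = k2 \<otimes> t2"
      using eng 1 by blast
    have "k \<otimes> t \<otimes> (h1 \<otimes> h2) = k \<otimes> t \<otimes> h1 \<otimes> h2"
      using eng genU T1 generate_in_carrier[OF A(2)] by (simp add: m_assoc subset_eq)
    with 1 2 show ?case by metis
  qed
  have "h \<in> generate G U" if h: "h \<in> H" for h
  proof -
    have hc: "h \<in> carrier G" using h subgroup.subset[OF H] by auto
    obtain k t where kt: "k \<in> generate G U" "t \<in> T1" "\<one> \<otimes> \<one> \<otimes> h = k \<otimes> t"
      using step[of h \<one> \<one>] A hc by (auto simp: generate.one T1_def)
    have c: "k \<in> carrier G" "t \<in> carrier G" using kt genU T1 by auto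
    have kH: "k \<in> H" using generate_subgroup_incl[OF UH H] kt by auto
    have "t = inv k \<otimes> h" using kt c hc by (simp add: group_normalize)
    then have "t \<in> H" using kH h H by (simp add: subgroup.m_closed subgroup.m_inv_closed)
    then have "t \<in> U" using kt by (auto simp: U_def)
    then show ?thesis using kt hc generate.eng[OF kt(1) generate.incl] by simp
  qed
  with fin UH show ?thesis by blast
qed

text \<open>The elements commuting with \<open>z\<close> form a subgroup containing
  \<open>U\<close>.\<close>

lemma centralizer_generate:
  assumes "U \<subseteq> carrier G" "z \<in> carrier G" "\<And>u. u \<in> U \<Longrightarrow> z \<in> centralizer u"
    and "h \<in> generate G U"
  shows "z \<otimes> h = h \<otimes> z"
proof -
  have "U \<subseteq> centralizer z" using assms by (force simp: centralizer_def)
  then have "generate G U \<subseteq> centralizer z"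
    using generate_subgroup_incl subgroup_centralizer assms(2) by blast
  with assms(4) show ?thesis by (auto simp: centralizer_def)
qed

lemma infinite_index_fc_center:
  assumes fg: "finitely_generated G" and nva: "\<not> virtually_abelian G"
  shows "infinite_index fc_center"
proof (rule ccontr)
  let ?H = fc_center
  note H = subgroup_fc_center
  note HG = subgroup.subset[OF H]
  assume "\<not> infinite_index ?H"
  then obtain K where K: "finite K" "K \<subseteq> carrier G"
    and cov: "\<And>x. x \<in> carrier G \<Longrightarrow> \<exists>k\<in>K. inv k \<otimes> x \<in> ?H"
    unfolding infinite_index_def by auto
  have covr: "\<exists>k\<in>K. x \<otimes> inv k \<in> ?H" if x: "x \<in> carrier G" for x
  proof -
    obtain k where "k \<in> K" "inv k \<otimes> x \<in> ?H" using cov x by blast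
    moreover from this K have "k \<in> carrier G" by auto
    ultimately show ?thesis using fc_center_commute[of "inv k" x] x by auto
  qed
  obtain A where A: "finite A" "A \<subseteq> carrier G" "generate G A = carrier G"
    using fg unfolding finitely_generated_def by auto
  obtain U where U: "finite U" "U \<subseteq> ?H" "?H \<subseteq> generate G U"
    using schreier[OF A H K covr] by auto
  have UG: "U \<subseteq> carrier G" using U HG by auto
  \<comment> \<open>As \<open>U\<close> generates the FC-centre, \<open>Z\<close> is the centre of
    the FC-centre.\<close>
  define Z where "Z = {z \<in> ?H. \<forall>u\<in>U. z \<in> centralizer u}"
  have ZG: "Z \<subseteq> carrier G" using HG by (auto simp: Z_def)
  have cent: "subgroup (centralizer u) G" if "u \<in> U" for u
    using that UG subgroup_centralizer by auto
  have Z: "subgroup Z G"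
  proof (rule subgroupI)
    show "Z \<subseteq> carrier G" by fact
    have "\<one> \<in> Z"
      by (simp add: Z_def subgroup.one_closed[OF H] subgroup.one_closed[OF cent])
    then show "Z \<noteq> {}" by auto
  qed (simp_all add: Z_def subgroup.m_inv_closed[OF H] subgroup.m_inv_closed[OF cent]
      subgroup.m_closed[OF H] subgroup.m_closed[OF cent])
  have "x \<otimes> y = y \<otimes> x" if "x \<in> Z" "y \<in> Z" for x y
    using centralizer_generate[OF UG, of x y] that U ZG by (auto simp: Z_def)
  then have "comm_group (G\<lparr>carrier := Z\<rparr>)"
    by (intro group.group_comm_groupI subgroup_imp_group Z) auto
  moreover have "finite (rcosets Z)"
  proof -
    \<comment> \<open>\<open>f g\<close> records the right coset of \<open>g\<close> modulo the
      FC-centre and the conjugates of the generators by \<open>inv g\<close>. It takes finitely many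
      values, and \<open>f x = f y\<close> puts \<open>x \<otimes> inv y\<close> into
      \<open>Z\<close>.\<close>
    define f where "f g = (SOME k. k \<in> K \<and> g \<otimes> inv k \<in> ?H, \<lambda>u\<in>U. inv g \<otimes> u \<otimes> g)" for g
    have f1: "fst (f g) \<in> K \<and> g \<otimes> inv (fst (f g)) \<in> ?H" if "g \<in> carrier G" for g
      unfolding f_def fst_conv by (rule someI_ex) (use covr[OF that] in blast)
    have f2: "snd (f g) \<in> (\<Pi>\<^sub>E u\<in>U. (\<lambda>g. g \<otimes> u \<otimes> inv g) ` carrier G)" if "g \<in> carrier G" for g
      using that by (auto simp: f_def intro!: image_eqI[of _ _ "inv g"])
    have "finite (\<Pi>\<^sub>E u\<in>U. (\<lambda>g. g \<otimes> u \<otimes> inv g) ` carrier G)"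
      by (intro finite_PiE U(1)) (use U in \<open>auto simp: fc_center_def\<close>)
    then have fin: "finite (K \<times> (\<Pi>\<^sub>E u\<in>U. (\<lambda>g. g \<otimes> u \<otimes> inv g) ` carrier G))"
      using K by (intro finite_cartesian_product)
    have "finite (f ` carrier G)"
      by (rule finite_subset[OF image_subsetI fin]) (simp only: mem_Times_iff f1 f2)
    then have "finite ((\<lambda>g. Z #> g) ` carrier G)"
    proof (rule finite_image_factor)
      fix x y assume xy: "x \<in> carrier G" "y \<in> carrier G" "f x = f y"
      define k where "k = fst (f x)"
      have k: "k \<in> carrier G" "x \<otimes> inv k \<in> ?H" "y \<otimes> inv k \<in> ?H"
        using f1[of x] f1[of y] xy K by (auto simp: k_def)
      have "x \<otimes> inv k \<otimes> inv (y \<otimes> inv k) \<in> ?H"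
        using k H by (simp add: subgroup.m_closed subgroup.m_inv_closed)
      then have "x \<otimes> inv y \<in> ?H" using k xy by (simp add: group_normalize)
      moreover have "x \<otimes> inv y \<in> centralizer u" if u: "u \<in> U" for u
      proof -
        have "inv x \<otimes> u \<otimes> x = inv y \<otimes> u \<otimes> y"
          using xy(3) u by (auto simp: f_def dest: fun_cong[of _ _ u])
        then show ?thesis
          using conj_eq_imp_centralizer[of u "inv x" "inv y"] xy u UG by auto
      qed
      ultimately have "x \<otimes> inv y \<in> Z" by (auto simp: Z_def)
      then have "x \<in> Z #> y"
        using xy ZG by (auto simp: r_coset_def group_normalize intro!: bexI[of _ "x \<otimes> inv y"])
      then show "Z #> x = Z #> y" using repr_independence[OF _ _ Z] xy by metis
    qed
    moreover have "rcosets Z = (\<lambda>g. Z #> g) ` carrier G" by (auto simp: RCOSETS_def)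
    ultimately show ?thesis by simp
  qed
  ultimately show False using nva Z unfolding virtually_abelian_def by blast
qed


section \<open>Generic elements\<close>

text \<open>Each forbidden condition confines \<open>g\<close> to one left coset of a centralizer or
  of the FC-centre, all of infinite index, so \<open>neumann_covering\<close> avoids them
  together.\<close>

lemma generic_conj:
  assumes inf: "infinite_index fc_center"
    and A: "finite A" "A \<subseteq> carrier G" "A \<inter> fc_center = {}"
    and "finite B" and C: "finite C" "C \<subseteq> carrier G"
  obtains g where "g \<in> carrier G" "\<And>a. a \<in> A \<Longrightarrow> g \<otimes> a \<otimes> inv g \<notin> B"
    "\<And>c. c \<in> C \<Longrightarrow> c \<otimes> g \<notin> fc_center"
proof -
  \<comment> \<open>\<open>w a b\<close> is one solution of the conjugacy equation; for an
    unsolvable equation it is arbitrary, hence the intersection with the carrier in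
    \<open>K\<close>.\<close>
  define w where "w a b = (SOME k. k \<in> carrier G \<and> k \<otimes> a \<otimes> inv k = b)" for a b
  have w: "w a (k \<otimes> a \<otimes> inv k) \<in> carrier G \<and>
      w a (k \<otimes> a \<otimes> inv k) \<otimes> a \<otimes> inv (w a (k \<otimes> a \<otimes> inv k)) = k \<otimes> a \<otimes> inv k"
    if "k \<in> carrier G" for a k
    unfolding w_def by (rule someI[of _ k]) (use that in auto)
  define K where "K = (case_prod w ` (A \<times> B) \<inter> carrier G) \<union> m_inv G ` C"
  have K: "finite K" "K \<subseteq> carrier G"
    using assms by (auto simp: K_def)
  have "subgroup (centralizer a) G \<and> infinite_index (centralizer a)" if "a \<in> A" for a
    using that A subgroup_centralizer infinite_index_centralizer by blast
  then have "\<exists>x\<in>carrier G. \<forall>H\<in>insert fc_center (centralizer ` A). \<forall>k\<in>K. inv k \<otimes> x \<notin> H"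
    by (intro neumann_covering) (use A(1) K inf subgroup_fc_center in auto)
  then obtain g where g: "g \<in> carrier G"
    "\<And>k. k \<in> K \<Longrightarrow> inv k \<otimes> g \<notin> fc_center"
    "\<And>a k. a \<in> A \<Longrightarrow> k \<in> K \<Longrightarrow> inv k \<otimes> g \<notin> centralizer a" by auto
  show ?thesis
  proof (rule that[OF g(1)])
    fix a assume a: "a \<in> A"
    show "g \<otimes> a \<otimes> inv g \<notin> B"
    proof
      assume b: "g \<otimes> a \<otimes> inv g \<in> B"
      define k where "k = w a (g \<otimes> a \<otimes> inv g)"
      have "k \<in> K" using a b w[OF g(1), of a] by (force simp: K_def k_def)
      moreover have "inv k \<otimes> g \<in> centralizer a"
        by (rule conj_eq_imp_centralizer) (use a A g w[OF g(1), of a] in \<open>auto simp: k_def\<close>)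
      ultimately show False using g a by auto
    qed
  next
    fix c assume c: "c \<in> C"
    then show "c \<otimes> g \<notin> fc_center" using g(2)[of "inv c"] C by (auto simp: K_def)
  qed
qed

text \<open>Infinite index always leaves an element outside the finitely many cosets already chosen.
  These representatives feed the pigeonhole argument below.\<close>

lemma infinite_index_transversal:
  assumes "infinite_index fc_center"
  shows "\<exists>Y. finite Y \<and> card Y = n \<and> Y \<subseteq> carrier G \<and>
    (\<forall>y\<in>Y. \<forall>z\<in>Y. y \<noteq> z \<longrightarrow> z \<otimes> inv y \<notin> fc_center)"
proof (induction n)
  case 0
  show ?case by (rule exI[of _ "{}"]) auto
next
  case (Suc n)
  then obtain Y where Y: "finite Y" "card Y = n" "Y \<subseteq> carrier G"
    "\<forall>y\<in>Y. \<forall>z\<in>Y. y \<noteq> z \<longrightarrow> z \<otimes> inv y \<notin> fc_center" by blast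
  have "\<exists>x\<in>carrier G. \<forall>k\<in>Y. inv k \<otimes> x \<notin> fc_center"
    using assms Y(1,3) by (simp add: infinite_index_def)
  then obtain x where x: "x \<in> carrier G" "\<And>k. k \<in> Y \<Longrightarrow> inv k \<otimes> x \<notin> fc_center" by blast
  have 1: "x \<otimes> inv y \<notin> fc_center" if "y \<in> Y" for y
    using x(2)[OF that] fc_center_commute[of "inv y" x] x(1) that Y by auto
  have 2: "y \<otimes> inv x \<notin> fc_center" if "y \<in> Y" for y
    using 1[OF that] fc_center_inv_iff[of "x \<otimes> inv y"] x that Y by (auto simp: inv_mult_group)
  have "x \<notin> Y"
    using 1 x subgroup.one_closed[OF subgroup_fc_center] by fastforce
  then show ?case using Y x 1 2 by (intro exI[of _ "insert x Y"]) auto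
qed

text \<open>
  If \<open>x a x = b\<close> holds for both \<open>x = g y\<close> and \<open>x = g z\<close>, then \<open>g\<close> conjugates \<open>z y\<inverse>\<close> to a
  prescribed element. Given more cosets \<open>y\<close> than equations, the pigeonhole principle thus
  reduces the quadratic equations to conjugacy equations.
\<close>
lemma generic_element:
  assumes inf: "infinite_index fc_center"
    and A: "finite A" "A \<subseteq> carrier G" "A \<inter> fc_center = {}"
    and B: "finite B" and C: "finite C" "C \<subseteq> carrier G" and D: "finite D" "D \<subseteq> carrier G"
  obtains g where "g \<in> carrier G" "\<And>a. a \<in> A \<Longrightarrow> g \<otimes> a \<otimes> inv g \<notin> B"
    "\<And>c. c \<in> C \<Longrightarrow> c \<otimes> g \<notin> fc_center" "\<And>d. d \<in> D \<Longrightarrow> g \<otimes> d \<otimes> g \<notin> B"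
proof -
  obtain Y where Y: "finite Y" "card Y = Suc (card (D \<times> B))" "Y \<subseteq> carrier G"
    "\<And>y z. y \<in> Y \<Longrightarrow> z \<in> Y \<Longrightarrow> y \<noteq> z \<Longrightarrow> z \<otimes> inv y \<notin> fc_center"
    using infinite_index_transversal[OF inf, of "Suc (card (D \<times> B))"] by blast
  \<comment> \<open>The first part transfers the conjugacy conditions from
    \<open>g \<otimes> y\<close> to \<open>g\<close>. The second, together with the new elements of
    \<open>B'\<close>, forbids \<open>g \<otimes> (z \<otimes> inv y) \<otimes> inv g = inv d
    \<otimes> inv z \<otimes> y \<otimes> d\<close>, the outcome of a collision.\<close>
  define A' where "A' = (\<lambda>(y, a). y \<otimes> a \<otimes> inv y) ` (Y \<times> A) \<union>
    (\<lambda>(y, z). z \<otimes> inv y) ` {(y, z) \<in> Y \<times> Y. y \<noteq> z}"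
  define B' where "B' = B \<union> (\<lambda>(d, y, z). inv d \<otimes> inv z \<otimes> y \<otimes> d) ` (D \<times> Y \<times> Y)"
  define C' where "C' = (\<lambda>(y, c). y \<otimes> c) ` (Y \<times> C)"
  have finA': "finite A'"
    using A Y unfolding A'_def
    by (intro finite_UnI finite_imageI finite_cartesian_product finite_subset[of "{(y, z) \<in> Y \<times> Y. y \<noteq> z}" "Y \<times> Y"]) auto
  have A'G: "A' \<subseteq> carrier G" using A Y by (auto simp: A'_def subset_eq)
  have A'F: "A' \<inter> fc_center = {}"
  proof -
    have "y \<otimes> a \<otimes> inv y \<notin> fc_center" if "y \<in> Y" "a \<in> A" for y a
      using fc_center_conj_iff[of a y] that A Y by blast
    then show ?thesis using Y(4) by (auto simp: A'_def)
  qed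
  have fin': "finite B'" "finite C'" using B C D Y by (auto simp: B'_def C'_def)
  have "C' \<subseteq> carrier G" using C Y by (auto simp: C'_def)
  then obtain g where g: "g \<in> carrier G" "\<And>a. a \<in> A' \<Longrightarrow> g \<otimes> a \<otimes> inv g \<notin> B'"
    "\<And>c. c \<in> C' \<Longrightarrow> c \<otimes> g \<notin> fc_center"
    using generic_conj[OF inf finA' A'G A'F fin'] by blast
  have "\<exists>y\<in>Y. \<forall>d\<in>D. g \<otimes> y \<otimes> d \<otimes> (g \<otimes> y) \<notin> B"
  proof (rule ccontr)
    assume "\<not> ?thesis"
    then have "\<forall>y\<in>Y. \<exists>d. d \<in> D \<and> g \<otimes> y \<otimes> d \<otimes> (g \<otimes> y) \<in> B" by blast
    from bchoice[OF this] obtain \<delta> where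
      \<delta>: "\<forall>y\<in>Y. \<delta> y \<in> D \<and> g \<otimes> y \<otimes> \<delta> y \<otimes> (g \<otimes> y) \<in> B" ..
    \<comment> \<open>If every \<open>y\<close> failed, \<open>q y\<close> would name an equation
      solved by \<open>g \<otimes> y\<close>; \<open>Y\<close> has one element more than there are
      equations.\<close>
    define q where "q y = (\<delta> y, g \<otimes> y \<otimes> \<delta> y \<otimes> (g \<otimes> y))" for y
    have "q ` Y \<subseteq> D \<times> B" using \<delta> by (auto simp: q_def)
    then have "card (q ` Y) < card Y"
      using card_mono[of "D \<times> B" "q ` Y"] B D Y by auto
    then have "\<not> inj_on q Y" using card_image[of q Y] by auto
    then obtain y z where yz: "y \<in> Y" "z \<in> Y" "y \<noteq> z" "q y = q z" by (auto simp: inj_on_def)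
    define d where "d = \<delta> y"
    have e: "\<delta> y = d" "\<delta> z = d" using yz(4) by (auto simp: q_def d_def)
    have dD: "d \<in> D" using \<delta> yz by (simp add: d_def)
    have c: "d \<in> carrier G" "y \<in> carrier G" "z \<in> carrier G" "g \<in> carrier G"
      using \<delta> yz D Y g by (auto simp: d_def)
    have "g \<otimes> y \<otimes> d \<otimes> (g \<otimes> y) = g \<otimes> z \<otimes> d \<otimes> (g \<otimes> z)"
      using yz(4) e by (simp add: q_def)
    then have "inv d \<otimes> inv z \<otimes> inv g \<otimes> (g \<otimes> y \<otimes> d \<otimes> (g \<otimes> y)) \<otimes> inv y \<otimes> inv g =
      inv d \<otimes> inv z \<otimes> inv g \<otimes> (g \<otimes> z \<otimes> d \<otimes> (g \<otimes> z)) \<otimes> inv y \<otimes> inv g" by simp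
    then have "g \<otimes> (z \<otimes> inv y) \<otimes> inv g = inv d \<otimes> inv z \<otimes> y \<otimes> d"
      using c by (simp add: group_normalize)
    moreover have "z \<otimes> inv y \<in> A'" using yz by (force simp: A'_def)
    moreover have "inv d \<otimes> inv z \<otimes> y \<otimes> d \<in> B'" using dD yz by (force simp: B'_def)
    ultimately show False using g(2) by metis
  qed
  then obtain y where y: "y \<in> Y" "\<And>d. d \<in> D \<Longrightarrow> g \<otimes> y \<otimes> d \<otimes> (g \<otimes> y) \<notin> B" by blast
  have yc: "y \<in> carrier G" using y Y by auto
  show ?thesis
  proof (rule that[of "g \<otimes> y"])
    show "g \<otimes> y \<in> carrier G" using g yc by simp
    fix a assume a: "a \<in> A"
    have "y \<otimes> a \<otimes> inv y \<in> A'" using a y by (force simp: A'_def)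
    then have "g \<otimes> (y \<otimes> a \<otimes> inv y) \<otimes> inv g \<notin> B" using g(2) by (auto simp: B'_def)
    moreover have "a \<in> carrier G" using a A by auto
    ultimately show "g \<otimes> y \<otimes> a \<otimes> inv (g \<otimes> y) \<notin> B"
      using g yc by (simp add: group_normalize)
  next
    fix c assume c: "c \<in> C"
    then have cc: "c \<in> carrier G" using C by auto
    have "y \<otimes> c \<in> C'" using c y by (force simp: C'_def)
    then have "y \<otimes> c \<otimes> g \<notin> fc_center" using g(3) by auto
    then show "c \<otimes> (g \<otimes> y) \<notin> fc_center"
      using fc_center_commute[of y "c \<otimes> g"] cc yc g by (simp add: m_assoc)
  qed (use y in auto)
qed


section \<open>Counting triangles\<close>

lemma symmetric_subset_iff:
  "symmetric_subset G S \<longleftrightarrow> S \<subseteq> carrier G \<and> (\<forall>x\<in>S. inv x \<in> S)"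
proof
  assume "symmetric_subset G S"
  then show "S \<subseteq> carrier G \<and> (\<forall>x\<in>S. inv x \<in> S)"
    unfolding symmetric_subset_def SET_INV_def by blast
next
  assume *: "S \<subseteq> carrier G \<and> (\<forall>x\<in>S. inv x \<in> S)"
  then have "\<exists>y\<in>S. x = inv y" if "x \<in> S" for x
    using that by (intro bexI[of _ "inv x"]) auto
  with * show "symmetric_subset G S"
    unfolding symmetric_subset_def SET_INV_def by blast
qed

text \<open>For symmetric \<open>S\<close>, this counts the triangles of the Cayley graph on an edge
  from \<open>x\<close> to \<open>x \<otimes> s\<close>; their third vertices are
  \<open>x \<otimes> u\<close>.\<close>

definition triangles :: "'a set \<Rightarrow> 'a \<Rightarrow> nat" where
  "triangles S s = card {u \<in> S. inv s \<otimes> u \<in> S}"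

text \<open>Both counts belong to the same edge read from its two ends; multiplication by
  \<open>s\<close> changes the base point.\<close>

lemma triangles_inv:
  assumes S: "symmetric_subset G S" and s: "s \<in> carrier G"
  shows "triangles S (inv s) = triangles S s"
proof -
  have SG: "S \<subseteq> carrier G" using S by (simp add: symmetric_subset_iff)
  have "bij_betw (\<lambda>u. s \<otimes> u) {u \<in> S. inv (inv s) \<otimes> u \<in> S} {u \<in> S. inv s \<otimes> u \<in> S}"
    by (rule bij_betwI[where g = "\<lambda>u. inv s \<otimes> u"])
       (use SG s in \<open>auto simp: group_normalize subset_eq\<close>)
  then show ?thesis unfolding triangles_def by (rule bij_betw_same_card)
qed

text \<open>
  Adding \<open>g\<^sup>\<plusminus>\<^sup>1\<close> and \<open>(g s)\<^sup>\<plusminus>\<^sup>1\<close> for a generic \<open>g\<close> creates no triangles on old edges other than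
  \<open>g\<inverse> \<cdot> g s = s\<close> and its inverse.
\<close>
lemma triangles_increase:
  assumes inf: "infinite_index fc_center"
    and S: "finite S" "symmetric_subset G S" "\<one> \<notin> S"
    and s: "s \<in> S" "s \<notin> fc_center"
  shows "\<exists>S'. finite S' \<and> symmetric_subset G S' \<and> \<one> \<notin> S' \<and> S \<subseteq> S' \<and>
    triangles S s < triangles S' s \<and>
    (\<forall>t\<in>S. t \<noteq> s \<and> t \<noteq> inv s \<longrightarrow> triangles S' t = triangles S t) \<and>
    (\<forall>t\<in>S'-S. triangles S' t \<le> 8)"
proof -
  have SG: "S \<subseteq> carrier G" and Sinv: "\<And>x. x \<in> S \<Longrightarrow> inv x \<in> S"
    using S by (auto simp: symmetric_subset_iff)
  have sc: "s \<in> carrier G" using s SG by auto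
  \<comment> \<open>A triangle with two sides in \<open>S\<close> has its third side in
    \<open>P\<close>, so new elements are kept outside \<open>P\<close>.\<close>
  define P where "P = insert \<one> (S \<union> (\<lambda>(u, v). u \<otimes> v) ` (S \<times> S))"
  have P: "finite P" "P \<subseteq> carrier G" using S SG by (auto simp: P_def)
  define P' where "P' = P \<union> (\<lambda>p. p \<otimes> inv s) ` P"
  have P': "finite P'" "P' \<subseteq> carrier G" using P sc by (auto simp: P'_def)
  \<comment> \<open>If \<open>g = p\<close> for some \<open>p\<close> in \<open>P'\<close>, then
    \<open>g \<otimes> s \<otimes> inv g\<close> is one of the added elements. The conjugacy
    condition therefore also forces \<open>g \<notin> P'\<close>.\<close>
  define B where "B = P' \<union> (\<lambda>p. p \<otimes> s \<otimes> inv p) ` P'"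
  have B: "finite B" using P' by (auto simp: B_def)
  obtain g where g: "g \<in> carrier G" "\<And>a. a \<in> {s} \<Longrightarrow> g \<otimes> a \<otimes> inv g \<notin> B"
    "\<And>d. d \<in> {\<one>, s} \<Longrightarrow> g \<otimes> d \<otimes> g \<notin> B"
    using generic_element[OF inf, of "{s}" B "{}" "{\<one>, s}"] B s sc by auto
  have gP': "g \<notin> P'" using g(2) by (auto simp: B_def)
  have gP: "g \<notin> P" using gP' by (auto simp: P'_def)
  have gsP: "g \<otimes> s \<notin> P"
  proof
    assume "g \<otimes> s \<in> P"
    then have "g \<otimes> s \<otimes> inv s \<in> P'" by (auto simp: P'_def)
    then show False using gP' g sc by (simp add: group_normalize)
  qed
  have PSS: "u \<otimes> v \<in> P" if "u \<in> S" "v \<in> S" for u v using that by (force simp: P_def)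
  have Pinv: "inv x \<in> P" if x: "x \<in> P" for x
  proof -
    consider "x = \<one>" | "x \<in> S" | u v where "u \<in> S" "v \<in> S" "x = u \<otimes> v"
      using x unfolding P_def by (elim insertE UnE imageE) auto
    then show ?thesis
    proof cases
      case 3
      then have "inv x = inv v \<otimes> inv u" using SG by (simp add: inv_mult_group subset_eq)
      then show ?thesis using PSS 3 Sinv by simp
    qed (use Sinv in \<open>auto simp: P_def\<close>)
  qed
  define \<Delta> where "\<Delta> = {g, inv g, g \<otimes> s, inv (g \<otimes> s)}"
  have \<Delta>G: "\<Delta> \<subseteq> carrier G" using g sc by (auto simp: \<Delta>_def)
  have \<Delta>inv: "inv x \<in> \<Delta>" if "x \<in> \<Delta>" for x using that g sc by (auto simp: \<Delta>_def)
  have \<Delta>P: "x \<notin> P" if "x \<in> \<Delta>" for x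
    using that gP gsP Pinv[of x] g sc by (auto simp: \<Delta>_def)
  have \<Delta>S: "x \<notin> S" if "x \<in> \<Delta>" for x using \<Delta>P[OF that] by (auto simp: P_def)
  define S' where "S' = S \<union> \<Delta>"
  have S'G: "S' \<subseteq> carrier G" using SG \<Delta>G by (auto simp: S'_def)
  have S'inv: "inv x \<in> S'" if "x \<in> S'" for x using that Sinv \<Delta>inv by (auto simp: S'_def)
  have finS': "finite S'" using S by (simp add: S'_def \<Delta>_def)
  have one: "\<one> \<notin> S'" using S \<Delta>P[of \<one>] by (auto simp: S'_def P_def)
  \<comment> \<open>Up to inversion the sixteen products are \<open>\<one>\<close>,
    \<open>s\<close>, and \<open>g g\<close>, \<open>g g s\<close>, \<open>g s g\<close>,
    \<open>g s g s\<close>, \<open>g s (inv g)\<close>; genericity keeps the last five out of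
    \<open>S\<close>.\<close>
  have new: "t = s \<or> t = inv s" if "u \<in> \<Delta>" "v \<in> \<Delta>" "u \<otimes> v = t" "t \<in> S" for u v t
  proof -
    have *: "x \<notin> S \<and> inv x \<notin> S" if "x \<in> carrier G" "x \<notin> S" for x
      using Sinv[of "inv x"] that by auto
    have S_B: "x \<in> B" if "x \<in> S \<or> x \<otimes> s \<in> S" "x \<in> carrier G" for x
    proof -
      have "x = x \<otimes> s \<otimes> inv s" using that sc by (simp add: group_normalize)
      then show ?thesis using that by (auto simp: B_def P'_def P_def)
    qed
    have gg: "g \<otimes> g \<notin> B" "g \<otimes> (s \<otimes> g) \<notin> B" "g \<otimes> (s \<otimes> inv g) \<notin> B"
      using g(2)[of s] g(3)[of \<one>] g(3)[of s] g(1) sc by (simp_all add: m_assoc)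
    note no = *[of "g \<otimes> g"] *[of "g \<otimes> g \<otimes> s"] *[of "g \<otimes> (s \<otimes> g)"]
      *[of "g \<otimes> (s \<otimes> g) \<otimes> s"] *[of "g \<otimes> (s \<otimes> inv g)"]
    have "g \<otimes> g \<notin> S" "g \<otimes> g \<otimes> s \<notin> S" "g \<otimes> (s \<otimes> g) \<notin> S" "g \<otimes> (s \<otimes> g) \<otimes> s \<notin> S"
      "g \<otimes> (s \<otimes> inv g) \<notin> S"
      using gg S_B g(1) sc by auto
    with no g(1) sc S(3) that show ?thesis
      by (auto simp: \<Delta>_def group_normalize)
  qed
  \<comment> \<open>One old and one new side would make the new one a product of two elements of
    \<open>S\<close>; two new sides are excluded by \<open>new\<close>.\<close>
  have old: "u \<in> S \<and> inv t \<otimes> u \<in> S"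
    if t: "t \<in> S" "t \<noteq> s" "t \<noteq> inv s" and u: "u \<in> S'" "inv t \<otimes> u \<in> S'" for t u
  proof -
    define v where "v = inv t \<otimes> u"
    have c: "t \<in> carrier G" "u \<in> carrier G" "v \<in> carrier G" "v \<in> S'"
      using t u SG S'G by (auto simp: v_def)
    have uv: "u \<otimes> inv v = t" using c by (simp add: v_def group_normalize)
    have uv': "u = t \<otimes> v" using c by (simp add: v_def group_normalize)
    consider "u \<in> \<Delta>" "v \<in> \<Delta>" | "u \<in> S" "v \<in> \<Delta>" | "v \<in> S" "u \<in> \<Delta>" | "u \<in> S" "v \<in> S"
      using u c by (auto simp: S'_def)
    then show ?thesis
    proof cases
      case 1
      then show ?thesis using new[OF 1(1) \<Delta>inv[OF 1(2)] uv t(1)] t by simp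
    next
      case 2
      then show ?thesis using PSS[of "inv t" u] Sinv[OF t(1)] \<Delta>P[of v] by (simp add: v_def)
    next
      case 3
      then show ?thesis using PSS[of t v] t(1) \<Delta>P[of u] uv' by simp
    next
      case 4
      then show ?thesis by (simp add: v_def)
    qed
  qed
  have "triangles S' t = triangles S t" if "t \<in> S" "t \<noteq> s" "t \<noteq> inv s" for t
  proof -
    have "{u \<in> S'. inv t \<otimes> u \<in> S'} = {u \<in> S. inv t \<otimes> u \<in> S}"
      using old[OF that] by (auto simp: S'_def)
    then show ?thesis by (simp add: triangles_def)
  qed
  moreover have "triangles S s < triangles S' s"
  proof -
    \<comment> \<open>The additional common neighbour of \<open>\<one>\<close> and \<open>s\<close>
      is \<open>inv g\<close>.\<close>
    have "inv s \<otimes> inv g = inv (g \<otimes> s)" using g sc by (simp add: inv_mult_group)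
    then have "inv g \<in> \<Delta>" "inv s \<otimes> inv g \<in> \<Delta>" by (simp_all add: \<Delta>_def)
    then have "inv g \<in> {u \<in> S'. inv s \<otimes> u \<in> S'} - {u \<in> S. inv s \<otimes> u \<in> S}"
      using \<Delta>S by (auto simp: S'_def)
    then have "{u \<in> S. inv s \<otimes> u \<in> S} \<subset> {u \<in> S'. inv s \<otimes> u \<in> S'}"
      by (auto simp: S'_def)
    then show ?thesis
      unfolding triangles_def using finS' by (intro psubset_card_mono) auto
  qed
  moreover have "triangles S' t \<le> 8" if t: "t \<in> S' - S" for t
  proof -
    have tc: "t \<in> carrier G" "t \<in> \<Delta>" using t S'G by (auto simp: S'_def)
    \<comment> \<open>At least one of the other two sides is new, as \<open>t \<notin> P\<close>.
      This gives two sets of at most four third vertices each.\<close>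
    have *: "{u \<in> S'. inv t \<otimes> u \<in> S'} \<subseteq> \<Delta> \<union> (\<lambda>v. t \<otimes> v) ` \<Delta>"
    proof
      fix u assume u: "u \<in> {u \<in> S'. inv t \<otimes> u \<in> S'}"
      have uc: "u \<in> carrier G" using u S'G by auto
      have "u \<notin> S \<or> inv t \<otimes> u \<notin> S"
        using PSS[of u "inv (inv t \<otimes> u)"] Sinv[of "inv t \<otimes> u"] \<Delta>P[of t] tc uc
        by (auto simp: group_normalize)
      moreover have "u = t \<otimes> (inv t \<otimes> u)" using uc tc by (simp add: group_normalize)
      ultimately show "u \<in> \<Delta> \<union> (\<lambda>v. t \<otimes> v) ` \<Delta>"
        using u by (auto simp: S'_def)
    qed
    have "card \<Delta> \<le> 4"
      using card_length[of "[g, inv g, g \<otimes> s, inv (g \<otimes> s)]"] by (simp add: \<Delta>_def)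
    have fin: "finite \<Delta>" by (simp add: \<Delta>_def)
    have "triangles S' t \<le> card (\<Delta> \<union> (\<lambda>v. t \<otimes> v) ` \<Delta>)"
      unfolding triangles_def using * fin by (intro card_mono) auto
    also have "\<dots> \<le> card \<Delta> + card ((\<lambda>v. t \<otimes> v) ` \<Delta>)" by (rule card_Un_le)
    also have "\<dots> \<le> card \<Delta> + card \<Delta>" using card_image_le[OF fin] by simp
    also have "\<dots> \<le> 8" using \<open>card \<Delta> \<le> 4\<close> by simp
    finally show ?thesis .
  qed
  ultimately show ?thesis
    using finS' S'G S'inv one
    by (intro exI[of _ S']) (auto simp: symmetric_subset_iff S'_def)
qed


text \<open>Iterates \<open>triangles_increase\<close>. Elements added in earlier rounds differ from
  \<open>s\<close> and \<open>inv s\<close>, so later rounds preserve their bound 8.\<close>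

lemma triangles_unbounded:
  assumes inf: "infinite_index fc_center"
    and S: "finite S" "symmetric_subset G S" "\<one> \<notin> S"
    and s: "s \<in> S" "s \<notin> fc_center"
  shows "\<exists>S'. finite S' \<and> symmetric_subset G S' \<and> \<one> \<notin> S' \<and> S \<subseteq> S' \<and> M < triangles S' s \<and>
    (\<forall>t\<in>S. t \<noteq> s \<and> t \<noteq> inv s \<longrightarrow> triangles S' t = triangles S t) \<and>
    (\<forall>t\<in>S'-S. triangles S' t \<le> 8)"
proof (induction M)
  case 0
  then show ?case using triangles_increase[OF assms] by (metis gr_implies_not0 gr0I)
next
  case (Suc M)
  then obtain S1 where S1: "finite S1" "symmetric_subset G S1" "\<one> \<notin> S1" "S \<subseteq> S1" "M < triangles S1 s"
    "\<And>t. t \<in> S \<Longrightarrow> t \<noteq> s \<Longrightarrow> t \<noteq> inv s \<Longrightarrow> triangles S1 t = triangles S t"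
    "\<And>t. t \<in> S1 - S \<Longrightarrow> triangles S1 t \<le> 8" by blast
  have "s \<in> S1" using S1 s by auto
  then obtain S2 where S2: "finite S2" "symmetric_subset G S2" "\<one> \<notin> S2" "S1 \<subseteq> S2"
    "triangles S1 s < triangles S2 s"
    "\<And>t. t \<in> S1 \<Longrightarrow> t \<noteq> s \<Longrightarrow> t \<noteq> inv s \<Longrightarrow> triangles S2 t = triangles S1 t"
    "\<And>t. t \<in> S2 - S1 \<Longrightarrow> triangles S2 t \<le> 8"
    using triangles_increase[OF inf S1(1,2,3) _ s(2)] by blast
  have "triangles S2 t \<le> 8" if t: "t \<in> S2 - S" for t
  proof (cases "t \<in> S1")
    case True
    moreover have "t \<noteq> s" "t \<noteq> inv s" using t s S(2) by (auto simp: symmetric_subset_iff)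
    ultimately show ?thesis using S2(6)[of t] S1(7)[of t] t by auto
  qed (use S2(7) t in auto)
  moreover have "triangles S2 t = triangles S t" if "t \<in> S" "t \<noteq> s" "t \<noteq> inv s" for t
    using S2(6)[of t] S1(6)[of t] S1(4) that by auto
  moreover have "Suc M < triangles S2 s" using S2(5) S1(5) by simp
  moreover have "S \<subseteq> S2" using S1 S2 by auto
  ultimately show ?case using S2(1,2,3) by blast
qed

text \<open>The elements of \<open>P\<close> are treated one by one: raising the count of
  \<open>p\<close> above all present counts isolates \<open>p\<close> up to inversion, and the
  colours separated earlier stay separated.\<close>

lemma triangles_separate:
  assumes inf: "infinite_index fc_center"
    and S0: "finite S0" "symmetric_subset G S0" "\<one> \<notin> S0"
    and P: "finite P" "P \<subseteq> S0" "P \<inter> fc_center = {}"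
  shows "\<exists>S. finite S \<and> symmetric_subset G S \<and> \<one> \<notin> S \<and> S0 \<subseteq> S \<and>
    (\<forall>p\<in>P. 8 < triangles S p \<and>
      (\<forall>t\<in>S. triangles S t = triangles S p \<longrightarrow> t = p \<or> t = inv p))"
  using P
proof (induction P rule: finite_induct)
  case empty
  then show ?case using S0 by blast
next
  case (insert p P)
  then obtain S where S: "finite S" "symmetric_subset G S" "\<one> \<notin> S" "S0 \<subseteq> S"
    "\<And>q. q \<in> P \<Longrightarrow> 8 < triangles S q"
    "\<And>q t. q \<in> P \<Longrightarrow> t \<in> S \<Longrightarrow> triangles S t = triangles S q \<Longrightarrow> t = q \<or> t = inv q" by auto
  have p: "p \<in> S" "p \<notin> fc_center" using insert.prems S by auto
  \<comment> \<open>The sum bounds every present count, and the summand 8 covers the elements still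
    to be added.\<close>
  define M where "M = 8 + (\<Sum>t\<in>S. triangles S t)"
  have M: "triangles S t \<le> M" if "t \<in> S" for t
    using member_le_sum[of t S "triangles S"] S(1) that by (simp add: M_def)
  obtain S' where S': "finite S'" "symmetric_subset G S'" "\<one> \<notin> S'" "S \<subseteq> S'" "M < triangles S' p"
    "\<And>t. t \<in> S \<Longrightarrow> t \<noteq> p \<Longrightarrow> t \<noteq> inv p \<Longrightarrow> triangles S' t = triangles S t"
    "\<And>t. t \<in> S' - S \<Longrightarrow> triangles S' t \<le> 8"
    using triangles_unbounded[OF inf S(1,2,3) p, of M] by blast
  have pc: "p \<in> carrier G" using p S(2) by (auto simp: symmetric_subset_iff)
  have p_inv: "triangles S' (inv p) = triangles S' p" using triangles_inv[OF S'(2) pc] .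
  have tp: "t = p \<or> t = inv p" if "t \<in> S'" "M < triangles S' t" for t
    using S'(6,7)[of t] M[of t] that by (fastforce simp: M_def)
  have "8 < triangles S' q \<and> (\<forall>t\<in>S'. triangles S' t = triangles S' q \<longrightarrow> t = q \<or> t = inv q)"
    if q: "q \<in> insert p P" for q
  \<comment> \<open>An earlier \<open>q\<close> may equal \<open>inv p\<close>; its count is then
    raised together with that of \<open>p\<close>.\<close>
  proof (cases "q = p \<or> q = inv p")
    case True
    then have *: "M < triangles S' q" "{p, inv p} = {q, inv q}" using S'(5) p_inv pc by auto
    have "t = q \<or> t = inv q" if "t \<in> S'" "triangles S' t = triangles S' q" for t
      using tp[OF that(1)] that(2) * by auto
    moreover have "8 \<le> M" by (simp add: M_def)
    ultimately show ?thesis using *(1) by auto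
  next
    case False
    then have qP: "q \<in> P" and qS: "q \<in> S" using q insert.prems S by auto
    then have eq: "triangles S' q = triangles S q" using S'(6) False by auto
    have "t = q \<or> t = inv q" if t: "t \<in> S'" "triangles S' t = triangles S q" for t
    proof -
      have "t \<in> S" using S'(7)[of t] S(5)[OF qP] t by force
      moreover have "t \<noteq> p \<and> t \<noteq> inv p" using S'(5) p_inv M[OF qS] t by auto
      ultimately show ?thesis using S'(6)[of t] S(6)[OF qP] t by auto
    qed
    then show ?thesis using eq S(5)[OF qP] by auto
  qed
  then show ?case using S'(1-4) S(4) by (intro exI[of _ S']) auto
qed


section \<open>Colour-preserving maps\<close>

text \<open>
  If \<open>\<phi>\<close> inverted the edge from \<open>x\<close> to \<open>x s\<close>, then comparing the two paths from \<open>x\<close> to \<open>x s g\<close>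
  would show that a generic \<open>g\<close> commutes with \<open>s\<close>.
\<close>
lemma orientation_witness:
  assumes inf: "infinite_index fc_center" and s: "s \<in> carrier G" "s \<notin> fc_center"
  shows "\<exists>g. g \<in> carrier G \<and> g \<notin> fc_center \<and> s \<otimes> g \<notin> fc_center \<and>
    (\<forall>\<phi> \<in> carrier G \<rightarrow> carrier G.
      (\<forall>x\<in>carrier G. \<forall>u\<in>{s, g, s \<otimes> g}. \<phi> (x \<otimes> u) \<in> {\<phi> x \<otimes> u, \<phi> x \<otimes> inv u}) \<longrightarrow>
      (\<forall>x\<in>carrier G. \<phi> (x \<otimes> s) = \<phi> x \<otimes> s))"
proof -
  \<comment> \<open>The excluded equations are \<open>g s (inv g) = s\<close>,
    \<open>g (inv s) g = inv s\<close> and \<open>g s s g = \<one>\<close>, from the possible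
    coincidences of path endpoints below.\<close>
  obtain g where g: "g \<in> carrier G"
    "\<And>a. a \<in> {s} \<Longrightarrow> g \<otimes> a \<otimes> inv g \<notin> {s, inv s, \<one>}"
    "\<And>c. c \<in> {\<one>, s} \<Longrightarrow> c \<otimes> g \<notin> fc_center"
    "\<And>d. d \<in> {inv s, s \<otimes> s} \<Longrightarrow> g \<otimes> d \<otimes> g \<notin> {s, inv s, \<one>}"
    using generic_element[OF inf, of "{s}" "{s, inv s, \<one>}" "{\<one>, s}" "{inv s, s \<otimes> s}"] s by auto
  have "\<phi> (x \<otimes> s) = \<phi> x \<otimes> s"
    if \<phi>: "\<phi> \<in> carrier G \<rightarrow> carrier G"
      "\<And>x u. x \<in> carrier G \<Longrightarrow> u \<in> {s, g, s \<otimes> g} \<Longrightarrow> \<phi> (x \<otimes> u) \<in> {\<phi> x \<otimes> u, \<phi> x \<otimes> inv u}"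
      and x: "x \<in> carrier G" for \<phi> x
  proof (rule ccontr)
    assume no: "\<phi> (x \<otimes> s) \<noteq> \<phi> x \<otimes> s"
    define a where "a = \<phi> x"
    have a: "a \<in> carrier G" using \<phi>(1) x by (auto simp: a_def)
    have xs: "\<phi> (x \<otimes> s) = a \<otimes> inv s" using \<phi>(2)[of x s] x no by (auto simp: a_def)
    \<comment> \<open>For an involution both orientations agree, so a failure rules this case
      out.\<close>
    have ss: "inv s \<noteq> s" using no xs by (auto simp: a_def)
    have "\<phi> (x \<otimes> s \<otimes> g) \<in> {a \<otimes> inv s \<otimes> g, a \<otimes> inv s \<otimes> inv g}"
      using \<phi>(2)[of "x \<otimes> s" g] x s xs by auto
    then have 1: "inv a \<otimes> \<phi> (x \<otimes> s \<otimes> g) \<in> {inv s \<otimes> g, inv s \<otimes> inv g}"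
      using a s g(1) by (auto simp: group_normalize)
    have "\<phi> (x \<otimes> s \<otimes> g) \<in> {a \<otimes> (s \<otimes> g), a \<otimes> inv (s \<otimes> g)}"
      using \<phi>(2)[of x "s \<otimes> g"] x s g(1) by (auto simp: a_def m_assoc)
    then have 2: "inv a \<otimes> \<phi> (x \<otimes> s \<otimes> g) \<in> {s \<otimes> g, inv g \<otimes> inv s}"
      using a s g(1) by (auto simp: group_normalize)
    consider "inv s \<otimes> g = s \<otimes> g" | "inv s \<otimes> g = inv g \<otimes> inv s"
      | "inv s \<otimes> inv g = s \<otimes> g" | "inv s \<otimes> inv g = inv g \<otimes> inv s"
      using 1 2 by auto
    then show False
    proof cases
      case 1
      then show ?thesis using ss s g(1) by simp
    next
      case 2
      then have "g \<otimes> (inv s \<otimes> g) = g \<otimes> (inv g \<otimes> inv s)" by simp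
      then show ?thesis using g(4)[of "inv s"] s g(1) by (simp add: group_normalize)
    next
      case 3
      then have "g \<otimes> s \<otimes> (inv s \<otimes> inv g) = g \<otimes> s \<otimes> (s \<otimes> g)" by simp
      then show ?thesis using g(4)[of "s \<otimes> s"] s g(1) by (simp add: group_normalize)
    next
      case 4
      then have "g \<otimes> (inv s \<otimes> inv g) = g \<otimes> (inv g \<otimes> inv s)" by simp
      then have "inv (g \<otimes> (inv s \<otimes> inv g)) = inv (inv s)" using s g(1) by (simp add: group_normalize)
      then show ?thesis using g(2)[of s] s g(1) by (simp add: group_normalize)
    qed
  qed
  then show ?thesis using g(1) g(3)[of \<one>] g(3)[of s] by (intro exI[of _ g]) auto
qed

text \<open>With a fixed \<open>b\<close> outside the FC-centre, each generator \<open>a\<close>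
  inside it is replaced by \<open>a \<otimes> b\<close>; keeping \<open>b\<close> recovers
  \<open>a\<close>.\<close>

lemma finitely_generated_not_fc:
  assumes fg: "finitely_generated G" and inf: "infinite_index fc_center"
  obtains T where "finite T" "T \<subseteq> carrier G" "T \<inter> fc_center = {}" "generate G T = carrier G"
proof -
  obtain A where A: "finite A" "A \<subseteq> carrier G" "generate G A = carrier G"
    using fg unfolding finitely_generated_def by auto
  have "\<exists>x\<in>carrier G. \<forall>k\<in>{\<one>}. inv k \<otimes> x \<notin> fc_center"
    using inf unfolding infinite_index_def by (metis empty_subsetI finite.emptyI finite.insertI insert_subset one_closed)
  then obtain b where b: "b \<in> carrier G" "b \<notin> fc_center" by auto
  define T where "T = insert b ((A - fc_center) \<union> (\<lambda>a. a \<otimes> b) ` (A \<inter> fc_center))"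
  have TG: "T \<subseteq> carrier G" using A b by (auto simp: T_def)
  have "a \<otimes> b \<notin> fc_center" if "a \<in> fc_center" for a
  proof
    assume "a \<otimes> b \<in> fc_center"
    then have "inv a \<otimes> (a \<otimes> b) \<in> fc_center"
      using that subgroup_fc_center by (simp add: subgroup.m_closed subgroup.m_inv_closed)
    moreover have "a \<in> carrier G" using that by (simp add: fc_center_def)
    ultimately show False using b by (simp add: group_normalize)
  qed
  then have TF: "T \<inter> fc_center = {}" using b by (auto simp: T_def)
  have "A \<subseteq> generate G T"
  proof
    fix a assume a: "a \<in> A"
    show "a \<in> generate G T"
    proof (cases "a \<in> fc_center")
      case True
      then have "a \<otimes> b \<otimes> inv b \<in> generate G T"
        using a by (intro generate.eng generate.inv generate.incl) (auto simp: T_def)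
      moreover have "a \<in> carrier G" using a A by auto
      ultimately show ?thesis using b by (simp add: group_normalize)
    qed (use a in \<open>auto simp: T_def intro: generate.incl\<close>)
  qed
  then have "generate G A \<subseteq> generate G T"
    using generate_subgroup_incl generate_is_subgroup[OF TG] by blast
  then have "generate G T = carrier G" using A generate_incl[OF TG] by auto
  moreover have "finite T" using A by (simp add: T_def)
  ultimately show thesis using that TG TF by simp
qed

text \<open>For an inverse generator, the hypothesis is applied at \<open>x \<otimes> inv h\<close>.
  Taking \<open>x = \<one>\<close> later identifies \<open>\<phi>\<close> as left multiplication by
  \<open>\<phi> \<one>\<close>.\<close>

lemma right_equivariant_generate:
  assumes T: "T \<subseteq> carrier G" and \<phi>: "\<phi> \<in> carrier G \<rightarrow> carrier G"
    "\<And>x s. x \<in> carrier G \<Longrightarrow> s \<in> T \<Longrightarrow> \<phi> (x \<otimes> s) = \<phi> x \<otimes> s"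
    and "g \<in> generate G T" "x \<in> carrier G"
  shows "\<phi> (x \<otimes> g) = \<phi> x \<otimes> g"
  using assms(4,5)
proof (induction g arbitrary: x rule: generate.induct)
  case one
  then show ?case using \<phi>(1) by (simp add: Pi_iff)
next
  case (incl h)
  then show ?case using \<phi>(2) by simp
next
  case (inv h)
  have h: "h \<in> carrier G" using inv T by auto
  have "\<phi> (x \<otimes> inv h \<otimes> h) = \<phi> (x \<otimes> inv h) \<otimes> h" using \<phi>(2) inv h by simp
  moreover have "\<phi> (x \<otimes> inv h) \<in> carrier G" using \<phi>(1) inv h by auto
  ultimately show ?case using inv h by (simp add: m_assoc)
next
  case (eng h1 h2)
  have "h1 \<in> carrier G" "h2 \<in> carrier G" using eng generate_in_carrier[OF T] by auto
  moreover have "\<phi> x \<in> carrier G" using \<phi>(1) eng by auto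
  ultimately show ?case using eng by (simp flip: m_assoc)
qed


section \<open>Automorphisms of Cayley graphs\<close>

text \<open>Left multiplication by \<open>x\<close> moves the base point from \<open>\<one>\<close>
  to \<open>x\<close>. The count thereby becomes a purely graph-theoretic quantity.\<close>

lemma triangles_eq_common_neighbours:
  assumes S: "symmetric_subset G S" and xy: "x \<in> carrier G" "y \<in> carrier G"
  shows "triangles S (inv x \<otimes> y) =
    card {z \<in> carrier G. {x, z} \<in> edges (Cay G S) \<and> {y, z} \<in> edges (Cay G S)}"
proof -
  have SG: "S \<subseteq> carrier G" using S by (simp add: symmetric_subset_iff)
  have "bij_betw (\<lambda>u. x \<otimes> u) {u \<in> S. inv (inv x \<otimes> y) \<otimes> u \<in> S}
    {z \<in> carrier G. inv x \<otimes> z \<in> S \<and> inv y \<otimes> z \<in> S}"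
    by (rule bij_betwI[where g = "\<lambda>z. inv x \<otimes> z"])
       (use SG xy in \<open>auto simp: group_normalize subset_eq\<close>)
  then have "triangles S (inv x \<otimes> y) = card {z \<in> carrier G. inv x \<otimes> z \<in> S \<and> inv y \<otimes> z \<in> S}"
    unfolding triangles_def by (rule bij_betw_same_card)
  also have "{z \<in> carrier G. inv x \<otimes> z \<in> S \<and> inv y \<otimes> z \<in> S} =
    {z \<in> carrier G. {x, z} \<in> edges (Cay G S) \<and> {y, z} \<in> edges (Cay G S)}"
    using edge_Cay_iff[OF S] xy by auto
  finally show ?thesis .
qed

text \<open>An automorphism maps common neighbours bijectively onto common neighbours of the
  images.\<close>

lemma graph_auto_Cay_triangles:
  assumes S: "symmetric_subset G S" and \<phi>: "\<phi> \<in> graph_auto (Cay G S)"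
    and xy: "x \<in> carrier G" "y \<in> carrier G"
  shows "triangles S (inv (\<phi> x) \<otimes> \<phi> y) = triangles S (inv x \<otimes> y)"
proof -
  have bij: "bij_betw \<phi> (carrier G) (carrier G)"
    using \<phi> by (simp add: graph_auto_def Bij_def)
  then have \<phi>G: "\<phi> z \<in> carrier G" if "z \<in> carrier G" for z
    using that bij_betwE by blast
  have E: "{u, v} \<in> edges (Cay G S) \<longleftrightarrow> {\<phi> u, \<phi> v} \<in> edges (Cay G S)"
    if "u \<in> carrier G" "v \<in> carrier G" for u v
    using \<phi> that by (simp add: graph_auto_def)
  define N where "N u v = {z \<in> carrier G. {u, z} \<in> edges (Cay G S) \<and> {v, z} \<in> edges (Cay G S)}" for u v
  have "\<phi> ` N x y = N (\<phi> x) (\<phi> y)"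
  proof
    show "\<phi> ` N x y \<subseteq> N (\<phi> x) (\<phi> y)" using E \<phi>G xy by (auto simp: N_def)
  next
    show "N (\<phi> x) (\<phi> y) \<subseteq> \<phi> ` N x y"
    proof
      fix w assume w: "w \<in> N (\<phi> x) (\<phi> y)"
      then obtain z where "z \<in> carrier G" "w = \<phi> z"
        using bij by (auto simp: N_def bij_betw_def)
      with w show "w \<in> \<phi> ` N x y" using E xy by (auto simp: N_def)
    qed
  qed
  moreover have "inj_on \<phi> (N x y)"
    using bij by (auto simp: N_def bij_betw_def intro: inj_on_subset)
  ultimately have "card (N (\<phi> x) (\<phi> y)) = card (N x y)" using card_image by metis
  then show ?thesis
    using triangles_eq_common_neighbours[OF S] xy \<phi>G by (simp add: N_def)
qed

lemma translation_graph_auto_Cay: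
  assumes S: "symmetric_subset G S" and g: "g \<in> carrier G"
  shows "(\<lambda>h\<in>carrier G. g \<otimes> h) \<in> graph_auto (Cay G S)"
proof -
  have "bij_betw (\<lambda>h\<in>carrier G. g \<otimes> h) (carrier G) (carrier G)"
    by (rule bij_betwI[where g = "\<lambda>h. inv g \<otimes> h"]) (use g in \<open>auto simp: group_normalize\<close>)
  then show ?thesis
    using edge_Cay_iff[OF S] g by (simp add: graph_auto_def Bij_def group_normalize)
qed

text \<open>The image edge has a colour in \<open>S\<close> with the same triangle count, which
  determines the colour up to inversion.\<close>

lemma graph_auto_Cay_color:
  assumes S: "symmetric_subset G S" and \<phi>: "\<phi> \<in> graph_auto (Cay G S)"
    and u: "u \<in> S" "\<And>t. t \<in> S \<Longrightarrow> triangles S t = triangles S u \<Longrightarrow> t = u \<or> t = inv u"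
    and x: "x \<in> carrier G"
  shows "\<phi> (x \<otimes> u) \<in> {\<phi> x \<otimes> u, \<phi> x \<otimes> inv u}"
proof -
  have uc: "u \<in> carrier G" using u S by (auto simp: symmetric_subset_iff)
  have \<phi>G: "\<phi> z \<in> carrier G" if "z \<in> carrier G" for z
    using that \<phi> bij_betwE by (fastforce simp: graph_auto_def Bij_def)
  define t where "t = inv (\<phi> x) \<otimes> \<phi> (x \<otimes> u)"
  have "{x, x \<otimes> u} \<in> edges (Cay G S)"
    using edge_Cay_iff[OF S] x uc u by (simp add: group_normalize)
  then have "{\<phi> x, \<phi> (x \<otimes> u)} \<in> edges (Cay G S)"
    using \<phi> x uc by (simp add: graph_auto_def)
  then have "t \<in> S" using edge_Cay_iff[OF S] \<phi>G x uc by (simp add: t_def)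
  moreover have "triangles S t = triangles S u"
    using graph_auto_Cay_triangles[OF S \<phi> x, of "x \<otimes> u"] x uc by (simp add: t_def group_normalize)
  ultimately have "t = u \<or> t = inv u" using u by blast
  moreover have "\<phi> (x \<otimes> u) = \<phi> x \<otimes> t"
    using \<phi>G x uc by (simp add: t_def group_normalize)
  ultimately show ?thesis by auto
qed

end

theorem theorem1p1:
  fixes G (structure)
  assumes "group G"
    and "finitely_generated G"
    and "\<not> virtually_abelian G"
  shows "\<exists>S. finite S \<and> S \<subseteq> carrier G - {\<one>} \<and> symmetric_subset G S \<and>
           generate G S = carrier G \<and>
           carrier (graph_AutoGroup (Cay G S)) = {(\<lambda>h\<in>carrier G. g \<otimes> h) |g. g \<in> carrier G}"
proof -
  interpret group G by fact
  have inf: "infinite_index fc_center" using infinite_index_fc_center assms by blast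
  obtain T where T: "finite T" "T \<subseteq> carrier G" "T \<inter> fc_center = {}" "generate G T = carrier G"
    using finitely_generated_not_fc[OF assms(2) inf] .
  have "\<forall>s\<in>T. \<exists>g. g \<in> carrier G \<and> g \<notin> fc_center \<and> s \<otimes> g \<notin> fc_center \<and>
    (\<forall>\<phi> \<in> carrier G \<rightarrow> carrier G.
      (\<forall>x\<in>carrier G. \<forall>u\<in>{s, g, s \<otimes> g}. \<phi> (x \<otimes> u) \<in> {\<phi> x \<otimes> u, \<phi> x \<otimes> inv u}) \<longrightarrow>
      (\<forall>x\<in>carrier G. \<phi> (x \<otimes> s) = \<phi> x \<otimes> s))"
    by (intro ballI orientation_witness inf) (use T in auto)
  from bchoice[OF this] obtain w where w: "\<forall>s\<in>T. w s \<in> carrier G \<and> w s \<notin> fc_center \<and>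
    s \<otimes> w s \<notin> fc_center \<and>
    (\<forall>\<phi> \<in> carrier G \<rightarrow> carrier G.
      (\<forall>x\<in>carrier G. \<forall>u\<in>{s, w s, s \<otimes> w s}. \<phi> (x \<otimes> u) \<in> {\<phi> x \<otimes> u, \<phi> x \<otimes> inv u}) \<longrightarrow>
      (\<forall>x\<in>carrier G. \<phi> (x \<otimes> s) = \<phi> x \<otimes> s))" ..
  \<comment> \<open>These are the colours that \<open>orientation_witness\<close> needs preserved up
    to inversion; all lie outside the FC-centre, so their counts can be separated.\<close>
  define P where "P = T \<union> w ` T \<union> (\<lambda>s. s \<otimes> w s) ` T"
  have P: "finite P" "P \<subseteq> carrier G" "P \<inter> fc_center = {}"
    using T w by (auto simp: P_def)
  define S0 where "S0 = P \<union> m_inv G ` P"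
  have P': "x \<in> carrier G \<and> x \<notin> fc_center" if "x \<in> P" for x using P that by auto
  have S0: "finite S0" "symmetric_subset G S0"
    using P(1) P' by (auto simp: S0_def symmetric_subset_iff)
  have "x \<notin> fc_center" if "x \<in> S0" for x
    using that P' fc_center_inv_iff by (auto simp: S0_def)
  then have "\<one> \<notin> S0" using subgroup.one_closed[OF subgroup_fc_center] by blast
  moreover have "P \<subseteq> S0" by (simp add: S0_def)
  ultimately obtain S where S: "finite S" "symmetric_subset G S" "\<one> \<notin> S" "S0 \<subseteq> S"
    "\<And>p t. p \<in> P \<Longrightarrow> t \<in> S \<Longrightarrow> triangles S t = triangles S p \<Longrightarrow> t = p \<or> t = inv p"
    using triangles_separate[OF inf S0 _ P(1) _ P(3)] by metis
  have SG: "S \<subseteq> carrier G" using S by (simp add: symmetric_subset_iff)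
  have PS: "P \<subseteq> S" using S(4) by (auto simp: S0_def)
  then have "T \<subseteq> S" by (auto simp: P_def)
  then have "generate G S = carrier G"
    using mono_generate[of T S] T(4) generate_incl[OF SG] by auto
  moreover have "carrier (graph_AutoGroup (Cay G S)) = {(\<lambda>h\<in>carrier G. g \<otimes> h) |g. g \<in> carrier G}"
  proof
    show "{(\<lambda>h\<in>carrier G. g \<otimes> h) |g. g \<in> carrier G} \<subseteq> carrier (graph_AutoGroup (Cay G S))"
      using translation_graph_auto_Cay[OF S(2)] by (auto simp: graph_AutoGroup_def)
  next
    show "carrier (graph_AutoGroup (Cay G S)) \<subseteq> {(\<lambda>h\<in>carrier G. g \<otimes> h) |g. g \<in> carrier G}"
    proof
      fix \<phi> assume "\<phi> \<in> carrier (graph_AutoGroup (Cay G S))"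
      then have \<phi>: "\<phi> \<in> graph_auto (Cay G S)" by (simp add: graph_AutoGroup_def)
      then have ext: "\<phi> \<in> extensional (carrier G)" and "bij_betw \<phi> (carrier G) (carrier G)"
        by (auto simp: graph_auto_def Bij_def)
      then have \<phi>G: "\<phi> \<in> carrier G \<rightarrow> carrier G" using bij_betw_imp_funcset by blast
      have col: "\<phi> (x \<otimes> u) \<in> {\<phi> x \<otimes> u, \<phi> x \<otimes> inv u}" if "x \<in> carrier G" "u \<in> P" for x u
        using graph_auto_Cay_color[OF S(2) \<phi> _ S(5) that(1)] that(2) PS by blast
      have eqv: "\<phi> (x \<otimes> s) = \<phi> x \<otimes> s" if "x \<in> carrier G" "s \<in> T" for x s
      proof -
        have "{s, w s, s \<otimes> w s} \<subseteq> P" using that by (auto simp: P_def)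
        then have "\<forall>x\<in>carrier G. \<forall>u\<in>{s, w s, s \<otimes> w s}. \<phi> (x \<otimes> u) \<in> {\<phi> x \<otimes> u, \<phi> x \<otimes> inv u}"
          using col by blast
        then show ?thesis using w \<phi>G that by blast
      qed
      have "\<phi> = (\<lambda>h\<in>carrier G. \<phi> \<one> \<otimes> h)"
      proof (rule extensionalityI[OF ext])
        fix h assume "h \<in> carrier G"
        then show "\<phi> h = (\<lambda>h\<in>carrier G. \<phi> \<one> \<otimes> h) h"
          using right_equivariant_generate[OF T(2) \<phi>G eqv, of h \<one>] T(4) by simp
      qed simp
      moreover have "\<phi> \<one> \<in> carrier G" using \<phi>G by auto
      ultimately show "\<phi> \<in> {(\<lambda>h\<in>carrier G. g \<otimes> h) |g. g \<in> carrier G}" by blast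
    qed
  qed
  ultimately show ?thesis using S(1,2,3) SG by (intro exI[of _ S]) auto
qed

end
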